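(* Let $(w_n)_{n\ge 1}$ be a sequence of bicomplex numbers with $w_n\notin\mathcal{NC}$ for all $n\geq 1$. Then the infinite product $\prod_{n=1}^{\infty} w_n$ converges to a nonsingular bicomplex number (that is, $\lim_{n\to\infty}\prod_{k=1}^{n}w_k$ exists in $\mathbb{T}$ and does not belong to $\mathcal{NC}$) if and only if the series $\sum_{n=1}^{\infty}\log w_n$ converges in $\mathbb{T}$, where $\log$ is the principal branch of the bicomplex logarithm.
   Context: Bicomplex numbers: $\mathbb{T}=\{z_1+\mathbf{i}_2z_2 : z_1,z_2\in\mathbb{C}(\mathbf{i}_1)\}$, where $\mathbb{C}(\mathbf{i}_1)=\{x+\mathbf{i}_1y:x,y\in\mathbb{R}\}$ is a copy of $\mathbb{C}$, $\mathbf{i}_1^2=\mathbf{i}_2^2=-1$, and $\mathbf{i}_1\mathbf{i}_2=\mathbf{i}_2\mathbf{i}_1=\mathbf{j}$ (so $\mathbf{j}^2=1$). $\mathbb{T}$ is a commutative ring. The norm is $\|z_1+\mathbf{i}_2z_2\|=\sqrt{|z_1|^2+|z_2|^2}$, and limits and convergence of sequences and series are with respect to this norm. Null cone: $\mathcal{NC}=\{z_1+\mathbf{i}_2z_2\in\mathbb{T}: z_1^2+z_2^2=0\}$, the set of singular (non-invertible) elements (including $0$). Elements not in $\mathcal{NC}$ are called nonsingular. Infinite product: $\prod_{n=1}^\infty w_n=\lim_{n\to\infty}\prod_{k=1}^n w_k$, when this limit exists in $\mathbb{T}$. Principal bicomplex logarithm: for $w=z_1+\mathbf{i}_2z_2\notin\mathcal{NC}$,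 let $|w|_{\mathbf{i}_1}=\sqrt{z_1^2+z_2^2}\in\mathbb{C}(\mathbf{i}_1)\setminus\{0\}$ (principal complex square root), and let $\mathrm{Arg}_{\mathbf{i}_1}w=\Theta\in\mathbb{C}(\mathbf{i}_1)$ be the unique solution of $\cos\Theta=z_1/|w|_{\mathbf{i}_1}$, $\sin\Theta=z_2/|w|_{\mathbf{i}_1}$ with $-\pi<\mathrm{Re}\,\Theta\le\pi$. Then $$\log w=\log\big||w|_{\mathbf{i}_1}\big|+\mathbf{i}_1\,\mathrm{Arg}(|w|_{\mathbf{i}_1})+\mathbf{i}_2\,\mathrm{Arg}_{\mathbf{i}_1}w,$$ where $\mathrm{Arg}$ is the usual principal complex argument in $(-\pi,\pi]$ and $\log\big||w|_{\mathbf{i}_1}\big|$ is the real logarithm of the ordinary absolute value of the complex number $|w|_{\mathbf{i}_1}$. *)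

theory Defs
  imports "HOL-Analysis.Analysis"
begin

(* BC z1 z2 stands for z1 + i2 * z2, where the type complex plays the role of C(i1). *)

datatype bicomplex = BC (bc1: complex) (bc2: complex)

lemma bicomplex_eq_iff: "x = y \<longleftrightarrow> bc1 x = bc1 y \<and> bc2 x = bc2 y"
  by (cases x; cases y) simp

lemma bicomplex_eqI: "bc1 x = bc1 y \<Longrightarrow> bc2 x = bc2 y \<Longrightarrow> x = y"
  by (simp add: bicomplex_eq_iff)

instantiation bicomplex :: comm_ring_1
begin

definition "0 = BC 0 0"
definition "1 = BC 1 0"
definition "x + y = BC (bc1 x + bc1 y) (bc2 x + bc2 y)"
definition "x - y = BC (bc1 x - bc1 y) (bc2 x - bc2 y)"
definition "- x = BC (- bc1 x) (- bc2 x)"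
definition "x * y = BC (bc1 x * bc1 y - bc2 x * bc2 y) (bc1 x * bc2 y + bc2 x * bc1 y)"

instance
  by standard
    (simp_all add: zero_bicomplex_def one_bicomplex_def plus_bicomplex_def minus_bicomplex_def
      uminus_bicomplex_def times_bicomplex_def algebra_simps)

end

lemma bc_zero [simp]: "bc1 0 = 0" "bc2 0 = 0"
  and bc_one [simp]: "bc1 1 = 1" "bc2 1 = 0"
  and bc_plus [simp]: "bc1 (x + y) = bc1 x + bc1 y" "bc2 (x + y) = bc2 x + bc2 y"
  and bc_minus [simp]: "bc1 (x - y) = bc1 x - bc1 y" "bc2 (x - y) = bc2 x - bc2 y"
  and bc_uminus [simp]: "bc1 (- x) = - bc1 x" "bc2 (- x) = - bc2 x"
  and bc_times [simp]: "bc1 (x * y) = bc1 x * bc1 y - bc2 x * bc2 y"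
    "bc2 (x * y) = bc1 x * bc2 y + bc2 x * bc1 y"
  by (simp_all add: zero_bicomplex_def one_bicomplex_def plus_bicomplex_def minus_bicomplex_def
      uminus_bicomplex_def times_bicomplex_def)

instantiation bicomplex :: real_vector
begin

definition "scaleR r x = BC (r *\<^sub>R bc1 x) (r *\<^sub>R bc2 x)"

instance
  by standard (simp_all add: scaleR_bicomplex_def bicomplex_eq_iff algebra_simps)

end

lemma bc_scaleR [simp]: "bc1 (r *\<^sub>R x) = r *\<^sub>R bc1 x" "bc2 (r *\<^sub>R x) = r *\<^sub>R bc2 x"
  by (simp_all add: scaleR_bicomplex_def)

(* The norm is not submultiplicative (only up to the factor sqrt 2), so bicomplex is not an
   instance of real_normed_algebra. *)

instantiation bicomplex :: real_normed_vector
begin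

definition "norm x = sqrt ((cmod (bc1 x))\<^sup>2 + (cmod (bc2 x))\<^sup>2)"
definition sgn_bicomplex_def: "sgn (x :: bicomplex) = x /\<^sub>R norm x"
definition dist_bicomplex_def: "dist (x :: bicomplex) y = norm (x - y)"
definition uniformity_bicomplex_def [code del]:
  "(uniformity :: (bicomplex \<times> bicomplex) filter)
    = (INF e\<in>{0 <..}. principal {(x, y). dist x y < e})"
definition open_bicomplex_def [code del]:
  "open (U :: bicomplex set) \<longleftrightarrow> (\<forall>x\<in>U. eventually (\<lambda>(x', y). x' = x \<longrightarrow> y \<in> U) uniformity)"

instance
proof
  fix r :: real and x y :: bicomplex
  show "norm x = 0 \<longleftrightarrow> x = 0"
    by (simp add: norm_bicomplex_def bicomplex_eq_iff sum_power2_eq_zero_iff)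
  show "norm (r *\<^sub>R x) = \<bar>r\<bar> * norm x"
    by (simp add: norm_bicomplex_def power_mult_distrib
        distrib_left [symmetric] real_sqrt_mult)
  have "norm (x + y) \<le> sqrt ((cmod (bc1 x) + cmod (bc1 y))\<^sup>2 + (cmod (bc2 x) + cmod (bc2 y))\<^sup>2)"
    unfolding norm_bicomplex_def
    by (intro real_sqrt_le_mono add_mono power_mono) (simp_all add: norm_triangle_ineq)
  also have "\<dots> \<le> norm x + norm y"
    unfolding norm_bicomplex_def by (rule real_sqrt_sum_squares_triangle_ineq)
  finally show "norm (x + y) \<le> norm x + norm y" .
qed (rule sgn_bicomplex_def dist_bicomplex_def open_bicomplex_def uniformity_bicomplex_def)+

end

declare uniformity_Abort[where 'a = bicomplex, code]

definition null_cone :: "bicomplex set" where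
  "null_cone = {w. (bc1 w)\<^sup>2 + (bc2 w)\<^sup>2 = 0}"

lemma null_cone_iff_not_unit: "w \<in> null_cone \<longleftrightarrow> \<not> w dvd 1"
proof
  assume "w \<in> null_cone"
  then have "w * BC (bc1 w) (- bc2 w) = 0"
    by (simp add: null_cone_def bicomplex_eq_iff power2_eq_square)
  moreover have "w = 0 \<longleftrightarrow> BC (bc1 w) (- bc2 w) = 0"
    by (simp add: bicomplex_eq_iff)
  ultimately show "\<not> w dvd 1"
    by (metis dvd_def mult.assoc mult.commute mult_1 mult_zero_right zero_neq_one)
next
  assume nu: "\<not> w dvd 1"
  show "w \<in> null_cone"
  proof (rule ccontr)
    let ?d = "(bc1 w)\<^sup>2 + (bc2 w)\<^sup>2"
    assume "w \<notin> null_cone"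
    then have "?d \<noteq> 0" by (simp add: null_cone_def)
    then have "1 = w * BC (bc1 w / ?d) (- bc2 w / ?d)"
      by (simp add: bicomplex_eq_iff power2_eq_square flip: add_divide_distrib)
    then show False using nu by (metis dvdI)
  qed
qed

definition bc_modulus :: "bicomplex \<Rightarrow> complex" where
  "bc_modulus w = csqrt ((bc1 w)\<^sup>2 + (bc2 w)\<^sup>2)"

definition bc_Arg :: "bicomplex \<Rightarrow> complex" where
  "bc_Arg w = (THE \<theta>. cos \<theta> = bc1 w / bc_modulus w \<and> sin \<theta> = bc2 w / bc_modulus w
                    \<and> - pi < Re \<theta> \<and> Re \<theta> \<le> pi)"

lemma bc_Arg_ex1:
  assumes "w \<notin> null_cone"
  shows "\<exists>!\<theta>. cos \<theta> = bc1 w / bc_modulus w \<and> sin \<theta> = bc2 w / bc_modulus w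
              \<and> - pi < Re \<theta> \<and> Re \<theta> \<le> pi"
proof -
  define m where "m = bc_modulus w"
  define c where "c = bc1 w / m"
  define s where "s = bc2 w / m"
  have m2: "m\<^sup>2 = (bc1 w)\<^sup>2 + (bc2 w)\<^sup>2" by (simp add: m_def bc_modulus_def)
  have "m \<noteq> 0" using assms m2 by (auto simp: null_cone_def)
  have "c\<^sup>2 + s\<^sup>2 = m\<^sup>2 / m\<^sup>2"
    unfolding c_def s_def power_divide m2 by (rule add_divide_distrib [symmetric])
  then have "c\<^sup>2 + s\<^sup>2 = 1" using \<open>m \<noteq> 0\<close> by simp
  then have u: "(c + \<i> * s) * (c - \<i> * s) = 1"
    by (simp add: algebra_simps power2_eq_square)
  then have u0: "c + \<i> * s \<noteq> 0" by auto
  have iff: "cos \<theta> = c \<and> sin \<theta> = s \<longleftrightarrow> exp (\<i> * \<theta>) = c + \<i> * s" for \<theta>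
  proof
    assume e: "exp (\<i> * \<theta>) = c + \<i> * s"
    have e': "exp (- (\<i> * \<theta>)) = c - \<i> * s"
      using u u0 unfolding exp_minus e by (simp add: field_simps)
    show "cos \<theta> = c \<and> sin \<theta> = s" unfolding cos_exp_eq sin_exp_eq e e' by simp
  qed (simp add: exp_Euler)
  have "\<exists>!\<theta>. (cos \<theta> = c \<and> sin \<theta> = s) \<and> - pi < Re \<theta> \<and> Re \<theta> \<le> pi"
    unfolding iff
  proof (rule ex1I)
    show "exp (\<i> * (- \<i> * Ln (c + \<i> * s))) = c + \<i> * s \<and>
      - pi < Re (- \<i> * Ln (c + \<i> * s)) \<and> Re (- \<i> * Ln (c + \<i> * s)) \<le> pi"
      using u0 mpi_less_Im_Ln Im_Ln_le_pi by (simp add: algebra_simps)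
  next
    fix \<theta> assume t: "exp (\<i> * \<theta>) = c + \<i> * s \<and> - pi < Re \<theta> \<and> Re \<theta> \<le> pi"
    then have "Ln (c + \<i> * s) = \<i> * \<theta>" by (intro Ln_unique) auto
    then show "\<theta> = - \<i> * Ln (c + \<i> * s)" by simp
  qed
  then show ?thesis by (simp add: c_def s_def m_def conj_assoc)
qed

definition bc_log :: "bicomplex \<Rightarrow> bicomplex" where
  "bc_log w = BC (complex_of_real (ln (cmod (bc_modulus w)))
                    + \<i> * complex_of_real (Arg (bc_modulus w)))
                 (bc_Arg w)"

end

(* The maps z1 + i2 z2 |-> z1 - i1 z2 and z1 + i2 z2 |-> z1 + i1 z2 identify the bicomplex numbers
   with C x C as a topological ring, the null cone being the pairs with a vanishing coordinate.
   Each coordinate of log w is a complex logarithm of the same coordinate of w, but not always the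
   principal one: for coordinates (a, b) and m = csqrt (a b) they are Ln m - Ln (b / m) and
   Ln m + Ln (b / m).  If the product converges, then a and b tend to 1, so both coordinates of the
   logarithm tend to 0, as they also do when the series converges.  Hence in either case
   they eventually agree with Ln a and Ln b, and the complex theorem applies. *)

theory Submission
  imports Defs
begin

text \<open>\<open>idem1\<close> and \<open>idem2\<close> are the coordinates with respect to the
  idempotents (1 + j)/2 and (1 - j)/2.\<close>

definition idem1 :: "bicomplex \<Rightarrow> complex" where
  "idem1 w = bc1 w - \<i> * bc2 w"

definition idem2 :: "bicomplex \<Rightarrow> complex" where
  "idem2 w = bc1 w + \<i> * bc2 w"

lemma bounded_linear_bc1: "bounded_linear bc1"
  and bounded_linear_bc2: "bounded_linear bc2"
  by (rule bounded_linear_intro[where K = 1];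
      simp add: norm_bicomplex_def real_le_rsqrt)+

lemma bounded_linear_idem1: "bounded_linear idem1"
  and bounded_linear_idem2: "bounded_linear idem2"
  unfolding idem1_def idem2_def
  by (intro bounded_linear_add bounded_linear_sub bounded_linear_const_mult
      bounded_linear_bc1 bounded_linear_bc2)+

text \<open>The product norm on pairs is the same square root, so this map is an isometry. It
  carries limits in the two components back to bicomplex limits.\<close>

lemma bounded_linear_BC: "bounded_linear (\<lambda>(x, y). BC x y)"
  by (rule bounded_linear_intro[where K = 1])
    (auto simp: bicomplex_eq_iff norm_bicomplex_def norm_prod_def)

lemma bicomplex_conv_idem:
  "w = BC ((idem1 w + idem2 w) / 2) ((idem2 w - idem1 w) / (2 * \<i>))"
  by (simp add: bicomplex_eq_iff idem1_def idem2_def)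

lemma tendsto_bicomplex_iff_idem:
  "(f \<longlongrightarrow> p) F \<longleftrightarrow>
    ((\<lambda>x. idem1 (f x)) \<longlongrightarrow> idem1 p) F \<and> ((\<lambda>x. idem2 (f x)) \<longlongrightarrow> idem2 p) F"
proof (intro iffI conjI)
  assume "((\<lambda>x. idem1 (f x)) \<longlongrightarrow> idem1 p) F \<and> ((\<lambda>x. idem2 (f x)) \<longlongrightarrow> idem2 p) F"
  then have "((\<lambda>x. (\<lambda>(u, v). BC u v) ((idem1 (f x) + idem2 (f x)) / 2,
        (idem2 (f x) - idem1 (f x)) / (2 * \<i>))) \<longlongrightarrow>
      (\<lambda>(u, v). BC u v) ((idem1 p + idem2 p) / 2, (idem2 p - idem1 p) / (2 * \<i>))) F"
    by (intro bounded_linear.tendsto[OF bounded_linear_BC] tendsto_intros) auto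
  then show "(f \<longlongrightarrow> p) F"
    by (simp only: split_conv bicomplex_conv_idem [symmetric])
qed (intro bounded_linear.tendsto[OF bounded_linear_idem1]
    bounded_linear.tendsto[OF bounded_linear_idem2]; assumption)+

lemma idem_surj: obtains p where "idem1 p = x" "idem2 p = y"
  \<comment> \<open>The witness solves z1 - \<i> z2 = x and z1 + \<i> z2 = y.\<close>
  by (rule that[of "BC ((x + y) / 2) ((y - x) / (2 * \<i>))"])
    (simp_all add: idem1_def idem2_def field_simps)

lemma summable_bicomplex_iff_idem:
  "summable f \<longleftrightarrow> summable (\<lambda>n. idem1 (f n)) \<and> summable (\<lambda>n. idem2 (f n))"
proof (intro iffI conjI)
  assume "summable (\<lambda>n. idem1 (f n)) \<and> summable (\<lambda>n. idem2 (f n))"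
  then obtain x y where "(\<lambda>n. idem1 (f n)) sums x" "(\<lambda>n. idem2 (f n)) sums y"
    by (auto simp: summable_def)
  moreover obtain p where "idem1 p = x" "idem2 p = y"
    by (rule idem_surj)
  ultimately have "f sums p"
    unfolding sums_def tendsto_bicomplex_iff_idem
    by (simp add: linear_sum[OF bounded_linear.linear[OF bounded_linear_idem1]]
        linear_sum[OF bounded_linear.linear[OF bounded_linear_idem2]])
  then show "summable f"
    by (rule sums_summable)
qed (intro bounded_linear.summable[OF bounded_linear_idem1]
    bounded_linear.summable[OF bounded_linear_idem2]; assumption)+

lemma idem_mult:
  "idem1 (x * y) = idem1 x * idem1 y" "idem2 (x * y) = idem2 x * idem2 y"
  by (simp_all add: idem1_def idem2_def algebra_simps)

lemma idem_one: "idem1 1 = 1" "idem2 1 = 1"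
  by (simp_all add: idem1_def idem2_def)

lemma idem_prod:
  "idem1 (\<Prod>k\<in>A. f k) = (\<Prod>k\<in>A. idem1 (f k))"
  "idem2 (\<Prod>k\<in>A. f k) = (\<Prod>k\<in>A. idem2 (f k))"
  by (induction A rule: infinite_finite_induct)
    (simp_all add: idem_mult idem_one)

lemma idem1_mult_idem2: "idem1 w * idem2 w = (bc1 w)\<^sup>2 + (bc2 w)\<^sup>2"
  by (simp add: idem1_def idem2_def algebra_simps power2_eq_square)

lemma null_cone_iff_idem: "w \<in> null_cone \<longleftrightarrow> idem1 w = 0 \<or> idem2 w = 0"
  by (simp add: null_cone_def flip: idem1_mult_idem2)

lemma bc_modulus_conv_idem: "bc_modulus w = csqrt (idem1 w * idem2 w)"
  by (simp add: bc_modulus_def idem1_mult_idem2)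

lemma bc_modulus_eq_0_iff: "bc_modulus w = 0 \<longleftrightarrow> w \<in> null_cone"
  by (simp add: bc_modulus_def null_cone_def)

text \<open>By Euler's formula, exp (\<i> \<theta>) = cos \<theta> + \<i> sin \<theta>. The bounds
  on Re \<theta> = Im (\<i> \<theta>) are exactly those that single out the principal
  logarithm.\<close>

lemma bc_Arg_conv_Ln:
  assumes "w \<notin> null_cone"
  shows "\<i> * bc_Arg w = Ln (idem2 w / bc_modulus w)"
proof -
  have *: "cos (bc_Arg w) = bc1 w / bc_modulus w \<and> sin (bc_Arg w) = bc2 w / bc_modulus w
      \<and> - pi < Re (bc_Arg w) \<and> Re (bc_Arg w) \<le> pi"
    unfolding bc_Arg_def by (rule theI'[OF bc_Arg_ex1[OF assms]])
  then have "exp (\<i> * bc_Arg w) = idem2 w / bc_modulus w"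
    by (simp add: exp_Euler idem2_def add_divide_distrib)
  then show ?thesis
    using * by (intro Ln_unique [symmetric]) auto
qed

lemma idem_bc_log:
  assumes "w \<notin> null_cone"
  shows "idem1 (bc_log w) = Ln (bc_modulus w) - Ln (idem2 w / bc_modulus w)"
    and "idem2 (bc_log w) = Ln (bc_modulus w) + Ln (idem2 w / bc_modulus w)"
proof -
  have "bc_modulus w \<noteq> 0"
    using assms by (simp add: bc_modulus_eq_0_iff)
  then have "bc1 (bc_log w) = Ln (bc_modulus w)"
    by (auto simp: bc_log_def complex_eq_iff Arg_eq_Im_Ln)
  moreover have "\<i> * bc2 (bc_log w) = Ln (idem2 w / bc_modulus w)"
    using bc_Arg_conv_Ln[OF assms] by (simp add: bc_log_def)
  ultimately show "idem1 (bc_log w) = Ln (bc_modulus w) - Ln (idem2 w / bc_modulus w)"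
    and "idem2 (bc_log w) = Ln (bc_modulus w) + Ln (idem2 w / bc_modulus w)"
    by (simp_all add: idem1_def idem2_def)
qed

text \<open>With coordinates a, b of w and m^2 = a b, the two exponentials are m / (b / m) = a and m
  (b / m) = b, whatever the branch.\<close>

lemma exp_idem_bc_log:
  assumes "w \<notin> null_cone"
  shows "exp (idem1 (bc_log w)) = idem1 w" "exp (idem2 (bc_log w)) = idem2 w"
proof -
  have nz: "bc_modulus w \<noteq> 0" "idem2 w \<noteq> 0"
    using assms by (auto simp: bc_modulus_eq_0_iff null_cone_iff_idem)
  have "(bc_modulus w)\<^sup>2 = idem1 w * idem2 w"
    by (simp add: bc_modulus_conv_idem)
  then show "exp (idem1 (bc_log w)) = idem1 w" "exp (idem2 (bc_log w)) = idem2 w"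
    using nz by (simp_all add: idem_bc_log[OF assms] exp_add exp_diff power2_eq_square)
qed

text \<open>\<open>csqrt\<close> and \<open>Ln\<close> are continuous at 1, away from their branch
  cuts, so the modulus and the quotient tend to 1 and both logarithms to 0.\<close>

lemma idem_bc_log_tendsto_0:
  assumes "\<And>n. w n \<notin> null_cone"
    and lim: "(\<lambda>n. idem1 (w n)) \<longlonglongrightarrow> 1" "(\<lambda>n. idem2 (w n)) \<longlonglongrightarrow> 1"
  shows "(\<lambda>n. idem1 (bc_log (w n))) \<longlonglongrightarrow> 0" "(\<lambda>n. idem2 (bc_log (w n))) \<longlonglongrightarrow> 0"
proof -
  have "(\<lambda>n. idem1 (w n) * idem2 (w n)) \<longlonglongrightarrow> 1"
    using tendsto_mult[OF lim] by simp
  then have m: "(\<lambda>n. bc_modulus (w n)) \<longlonglongrightarrow> 1"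
    unfolding bc_modulus_conv_idem
    using isCont_tendsto_compose[OF continuous_at_csqrt[of 1]] by simp
  have q: "(\<lambda>n. idem2 (w n) / bc_modulus (w n)) \<longlonglongrightarrow> 1"
    using tendsto_divide[OF lim(2) m] by simp
  have L: "(\<lambda>n. Ln (bc_modulus (w n))) \<longlonglongrightarrow> 0"
    "(\<lambda>n. Ln (idem2 (w n) / bc_modulus (w n))) \<longlonglongrightarrow> 0"
    using tendsto_Ln[OF m] tendsto_Ln[OF q] by simp_all
  show "(\<lambda>n. idem1 (bc_log (w n))) \<longlonglongrightarrow> 0" "(\<lambda>n. idem2 (bc_log (w n))) \<longlonglongrightarrow> 0"
    using tendsto_diff[OF L] tendsto_add[OF L] by (simp_all add: idem_bc_log assms(1))
qed

text \<open>Small terms are eventually recovered by \<open>Ln\<close> from their exponentials. The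
  constant sequence 2 pi \<i> shows why the terms must tend to 0.\<close>

lemma summable_iff_convergent_prod_exp:
  fixes z :: "nat \<Rightarrow> complex"
  assumes "z \<longlonglongrightarrow> 0"
  shows "summable z \<longleftrightarrow> convergent_prod (\<lambda>n. exp (z n))"
proof -
  have "(\<lambda>n. Im (z n)) \<longlonglongrightarrow> 0"
    using tendsto_Im[OF assms] by simp
  then have "\<forall>\<^sub>F n in sequentially. -pi < Im (z n) \<and> Im (z n) < pi"
    by (intro eventually_conj order_tendstoD) auto
  then have "\<forall>\<^sub>F n in sequentially. z n = Ln (exp (z n))"
    by eventually_elim simp
  then have "summable z \<longleftrightarrow> summable (\<lambda>n. Ln (exp (z n)))"
    by (rule summable_cong)
  then show ?thesis
    by (simp add: convergent_prod_iff_summable_complex)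
qed

text \<open>The library states this for products over i \<le> n; shifting the sequence by one
  preserves the limit.\<close>

lemma convergent_prod_iff_lessThan_nz_lim:
  fixes f :: "nat \<Rightarrow> complex"
  assumes "\<And>i. f i \<noteq> 0"
  shows "convergent_prod f \<longleftrightarrow> (\<exists>L. (\<lambda>n. \<Prod>i<n. f i) \<longlonglongrightarrow> L \<and> L \<noteq> 0)"
  by (simp add: convergent_prod_iff_nz_lim[OF assms] flip: lessThan_Suc_atMost
      filterlim_sequentially_Suc[of "\<lambda>n. \<Prod>i<n. f i"])

lemma bicomplex_prod_tendsto_iff:
  assumes "\<And>n. w n \<notin> null_cone"
  shows "(\<exists>p. (\<lambda>n. \<Prod>k<n. w k) \<longlonglongrightarrow> p \<and> p \<notin> null_cone)
    \<longleftrightarrow> convergent_prod (\<lambda>n. idem1 (w n)) \<and> convergent_prod (\<lambda>n. idem2 (w n))"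
proof -
  have nz: "idem1 (w n) \<noteq> 0" "idem2 (w n) \<noteq> 0" for n
    using assms by (auto simp: null_cone_iff_idem)
  show ?thesis
    unfolding tendsto_bicomplex_iff_idem idem_prod null_cone_iff_idem
      convergent_prod_iff_lessThan_nz_lim[OF nz(1)] convergent_prod_iff_lessThan_nz_lim[OF nz(2)]
    \<comment> \<open>Two separate complex limits are the coordinates of a single p.\<close>
    by (metis idem_surj)
qed

theorem theorem1:
  fixes w :: "nat \<Rightarrow> bicomplex"
  assumes "\<And>n. n \<ge> 1 \<Longrightarrow> w n \<notin> null_cone"
  shows "(\<exists>p. (\<lambda>n. \<Prod>k=1..n. w k) \<longlonglongrightarrow> p \<and> p \<notin> null_cone)
           \<longleftrightarrow> summable (\<lambda>n. bc_log (w (Suc n)))"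
proof -
  \<comment> \<open>The hypothesis says nothing about \<open>w 0\<close>; after the shift every term
    is nonsingular.\<close>
  define v where "v n = w (Suc n)" for n
  define x where "x n = idem1 (bc_log (v n))" for n
  define y where "y n = idem2 (bc_log (v n))" for n
  have v: "v n \<notin> null_cone" for n
    using assms by (simp add: v_def)
  have exp_xy: "exp (x n) = idem1 (v n)" "exp (y n) = idem2 (v n)" for n
    using exp_idem_bc_log[OF v] by (simp_all add: x_def y_def)
  have "(\<Prod>k=1..n. w k) = (\<Prod>k<n. v k)" for n
    unfolding v_def by (simp add: prod.atLeast1_atMost_eq)
  then have "(\<exists>p. (\<lambda>n. \<Prod>k=1..n. w k) \<longlonglongrightarrow> p \<and> p \<notin> null_cone) \<longleftrightarrow>
      convergent_prod (\<lambda>n. exp (x n)) \<and> convergent_prod (\<lambda>n. exp (y n))"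
    by (simp add: bicomplex_prod_tendsto_iff[OF v] exp_xy)
  also have "\<dots> \<longleftrightarrow> summable x \<and> summable y"
  \<comment> \<open>Either side forces both sequences to tend to 0, so if one does not, both sides
    are false.\<close>
  proof (cases "x \<longlonglongrightarrow> 0 \<and> y \<longlonglongrightarrow> 0")
    case True
    then show ?thesis
      by (simp add: summable_iff_convergent_prod_exp)
  next
    case False
    then have "\<not> (summable x \<and> summable y)"
      using summable_LIMSEQ_zero by blast
    moreover have "\<not> (convergent_prod (\<lambda>n. exp (x n)) \<and> convergent_prod (\<lambda>n. exp (y n)))"
    proof
      assume "convergent_prod (\<lambda>n. exp (x n)) \<and> convergent_prod (\<lambda>n. exp (y n))"
      \<comment> \<open>The factors of a convergent product tend to 1.\<close>
      then have "(\<lambda>n. idem1 (v n)) \<longlonglongrightarrow> 1" "(\<lambda>n. idem2 (v n)) \<longlonglongrightarrow> 1"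
        using convergent_prod_imp_LIMSEQ by (auto simp flip: exp_xy)
      from idem_bc_log_tendsto_0[OF v this] False show False
        by (simp add: x_def [abs_def] y_def [abs_def])
    qed
    ultimately show ?thesis
      by blast
  qed
  also have "\<dots> \<longleftrightarrow> summable (\<lambda>n. bc_log (w (Suc n)))"
    by (simp add: summable_bicomplex_iff_idem[of "\<lambda>n. bc_log (w (Suc n))"]
        x_def [abs_def] y_def [abs_def] v_def)
  finally show ?thesis .
qed

end
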